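(* Let $f\colon\mathbb{N}\to\mathbb{N}^+$ be any function with $f(n)\in O(n)$. Then there is a family of temporal bi-cliques $\{D_n\}_{n\in\mathbb{N}}=\{(A_n,B_n,\lambda_n)\}_{n\in\mathbb{N}}$, in each of which the labels of the edges incident to any one vertex are pairwise distinct, such that (1) $|A_n|=|B_n|\in\Theta(n)$; (2) $\max_{e}|\mathrm{In}(e)\cap\mathrm{Out}(e)|\in O(f(n))$, the maximum over all edges $e$ of $D_n$; and (3) $\min_e|M(e)|\in\Omega(n f(n))$, the minimum over all edges $e$ of $D_n$, where $M(e)$ is the set of edges of $D_n$ that are not $e$-reverted.
   Context: A temporal bi-clique $(A,B,\lambda)$ is the complete bipartite graph with disjoint parts $A,B$ with an edge labeling $\lambda$ into a totally ordered set of times (e.g. $\mathbb{N}$). A path $v_1\dots v_k$ is temporal if $\lambda(\{v_i,v_{i+1}\})\le\lambda(\{v_{i+1},v_{i+2}\})$ for all $i\in[k-2]$. For a vertex $v$ and time $t$, $\mathrm{In}_v(t)$ is the set of vertices reaching $v$ by a temporal path with all labels at most $t$, and $\mathrm{Out}_v(t)$ the set of vertices $v$ reaches by a temporal path with all labels at least $t$ (both contain $v$); for $e=\{u,v\}$, $\mathrm{In}(e)=\mathrm{In}_u(\lambda(e))\cup\mathrm{In}_v(\lambda(e))$ and $\mathrm{Out}(e)=\mathrm{Out}_u(\lambda(e))\cup\mathrm{Out}_v(\lambda(e))$. $\pi^-(v)$ ($\pi^+(v)$) is the neighbor joined to $v$ by the edge of minimum (maximum) label. For $e=\{a,b\}$,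 an edge $\{a',b'\}$ ($a'\in A,b'\in B$) is $e$-reverted if $\lambda(\{a',b\})\le\lambda(\{\pi^+(b'),b\})$ or $\lambda(\{\pi^-(a'),a\})\le\lambda(\{b',a\})$. *)

theory Defs
  imports Complex_Main "HOL-Library.Landau_Symbols"
begin

definition biclique_edges :: "'v set \<Rightarrow> 'v set \<Rightarrow> 'v set set" where
  "biclique_edges A B = {{a, b} | a b. a \<in> A \<and> b \<in> B}"

text \<open>Only the values of the labeling on \<open>biclique_edges A B\<close> are relevant. The parts are required
  to be nonempty so that the maxima and minima over all edges are well defined.\<close>

definition temporal_biclique :: "'v set \<Rightarrow> 'v set \<Rightarrow> ('v set \<Rightarrow> 't::linorder) \<Rightarrow> bool" where
  "temporal_biclique A B lam \<longleftrightarrow>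
     finite A \<and> finite B \<and> A \<noteq> {} \<and> B \<noteq> {} \<and> A \<inter> B = {}"

definition locally_distinct :: "'v set \<Rightarrow> 'v set \<Rightarrow> ('v set \<Rightarrow> 't::linorder) \<Rightarrow> bool" where
  "locally_distinct A B lam \<longleftrightarrow>
     (\<forall>v \<in> A \<union> B. inj_on lam {e \<in> biclique_edges A B. v \<in> e})"

text \<open>The list of edges traversed by a sequence of vertices.\<close>

fun path_edges :: "'v list \<Rightarrow> 'v set list" where
  "path_edges (u # v # p) = {u, v} # path_edges (v # p)"
| "path_edges _ = []"

text \<open>A path has at least one vertex and no repeated vertices; \<open>sorted\<close> is the non-strict order, and
  a path with a single vertex has no edges.\<close>

definition temporal_path :: "'v set \<Rightarrow> 'v set \<Rightarrow> ('v set \<Rightarrow> 't::linorder) \<Rightarrow> 'v list \<Rightarrow> bool" where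
  "temporal_path A B lam p \<longleftrightarrow>
     p \<noteq> [] \<and> set p \<subseteq> A \<union> B \<and> distinct p \<and>
     set (path_edges p) \<subseteq> biclique_edges A B \<and> sorted (map lam (path_edges p))"

definition In_vertex :: "'v set \<Rightarrow> 'v set \<Rightarrow> ('v set \<Rightarrow> 't::linorder) \<Rightarrow> 'v \<Rightarrow> 't \<Rightarrow> 'v set" where
  "In_vertex A B lam v t =
     {u. \<exists>p. temporal_path A B lam p \<and> hd p = u \<and> last p = v \<and>
             (\<forall>e \<in> set (path_edges p). lam e \<le> t)}"

definition Out_vertex :: "'v set \<Rightarrow> 'v set \<Rightarrow> ('v set \<Rightarrow> 't::linorder) \<Rightarrow> 'v \<Rightarrow> 't \<Rightarrow> 'v set" where
  "Out_vertex A B lam v t =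
     {u. \<exists>p. temporal_path A B lam p \<and> hd p = v \<and> last p = u \<and>
             (\<forall>e \<in> set (path_edges p). t \<le> lam e)}"

definition In_edge :: "'v set \<Rightarrow> 'v set \<Rightarrow> ('v set \<Rightarrow> 't::linorder) \<Rightarrow> 'v set \<Rightarrow> 'v set" where
  "In_edge A B lam e = (\<Union>v\<in>e. In_vertex A B lam v (lam e))"

definition Out_edge :: "'v set \<Rightarrow> 'v set \<Rightarrow> ('v set \<Rightarrow> 't::linorder) \<Rightarrow> 'v set \<Rightarrow> 'v set" where
  "Out_edge A B lam e = (\<Union>v\<in>e. Out_vertex A B lam v (lam e))"

text \<open>The two extremal neighbors are uniquely determined if the labeling is locally distinct.\<close>

definition pi_minus :: "'v set \<Rightarrow> 'v set \<Rightarrow> ('v set \<Rightarrow> 't::linorder) \<Rightarrow> 'v \<Rightarrow> 'v" where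
  "pi_minus A B lam v = (ARG_MIN (\<lambda>u. lam {v, u}) u. {v, u} \<in> biclique_edges A B)"

definition pi_plus :: "'v set \<Rightarrow> 'v set \<Rightarrow> ('v set \<Rightarrow> 't::linorder) \<Rightarrow> 'v \<Rightarrow> 'v" where
  "pi_plus A B lam v = (ARG_MAX (\<lambda>u. lam {v, u}) u. {v, u} \<in> biclique_edges A B)"

text \<open>\<open>reverted A B lam e e'\<close> means that \<open>e'\<close> is \<open>e\<close>-reverted. As \<open>A\<close> and \<open>B\<close> are disjoint, the
  endpoints \<open>a, b, a', b'\<close> are determined by the edges.\<close>

definition reverted :: "'v set \<Rightarrow> 'v set \<Rightarrow> ('v set \<Rightarrow> 't::linorder) \<Rightarrow> 'v set \<Rightarrow> 'v set \<Rightarrow> bool" where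
  "reverted A B lam e e' \<longleftrightarrow>
     (\<exists>a\<in>A. \<exists>b\<in>B. \<exists>a'\<in>A. \<exists>b'\<in>B. e = {a, b} \<and> e' = {a', b'} \<and>
        (lam {a', b} \<le> lam {pi_plus A B lam b', b} \<or>
         lam {pi_minus A B lam a', a} \<le> lam {b', a}))"

definition non_reverted :: "'v set \<Rightarrow> 'v set \<Rightarrow> ('v set \<Rightarrow> 't::linorder) \<Rightarrow> 'v set \<Rightarrow> 'v set set" where
  "non_reverted A B lam e = {e' \<in> biclique_edges A B. \<not> reverted A B lam e e'}"

end

theory Submission
  imports Defs "HOL-Number_Theory.Cong"
begin

text \<open>Split each part into \<open>m\<close> blocks of size \<open>k\<close>. Between blocks, label edges by the shifted
  matching \<open>(j - i) mod m\<close>; ties are broken by the shifted matching \<open>(y - x) mod k\<close> of the offsets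
  inside the blocks. Along a temporal path the block index moves alternately forwards and backwards
  by monotone amounts. Hence paths into an edge between blocks \<open>i\<close> and \<open>j\<close> start in the cyclic
  interval from \<open>i\<close> to \<open>j\<close> and paths out of it end in the complementary one. The two meet only in
  the end blocks, so at most \<open>2 * k\<close> vertices are in both. An edge \<open>{a', b'}\<close> inside a single block
  other than that of \<open>b\<close> is non-reverted as soon as \<open>b'\<close> precedes \<open>a'\<close> in the offset order seen
  from \<open>a\<close>. This gives \<open>(m - 1) * k * (k - 1) / 2\<close> non-reverted edges for every \<open>{a, b}\<close>. Taking
  \<open>k\<close> of order \<open>f n\<close> and \<open>m\<close> of order \<open>n / k\<close> proves the claim.\<close>

section \<open>Integer congruences and the triangular sum\<close>

lemma cong_int_close_imp_eq:
  fixes x y n :: int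
  assumes "[x = y] (mod n)" "\<bar>x - y\<bar> < n"
  shows "x = y"
  using assms by (metis cong_iff_dvd_diff dvd_imp_le_int abs_of_nonneg abs_ge_zero
      eq_iff_diff_eq_0 leD order_le_less_trans order_less_imp_le)

lemma cong_diff_left_cancel:
  fixes x y z n :: int
  shows "[x - y = x - z] (mod n) \<longleftrightarrow> [y = z] (mod n)"
  by (simp add: cong_iff_dvd_diff dvd_diff_commute)

lemma cong_diff_right_cancel:
  fixes x y z n :: int
  shows "[y - x = z - x] (mod n) \<longleftrightarrow> [y = z] (mod n)"
  by (simp add: cong_iff_dvd_diff)

lemma two_sum_lessThan: "2 * (\<Sum>u<n. u) = n * (n - 1)" for n :: nat
  by (induction n) (auto simp: algebra_simps)

section \<open>The two parts, their blocks and the labeling\<close>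

locale block_shift =
  fixes m k :: nat
  assumes m_gt_1: "1 < m" and k_pos: "0 < k"
begin

definition A :: "nat set" where "A = {..<m * k}"

definition B :: "nat set" where "B = {m * k..<2 * (m * k)}"

text \<open>The blocks of \<open>B\<close> have indices \<open>m, ..., 2 * m - 1\<close>, which
  agree modulo \<open>m\<close> with those of \<open>A\<close>. The subtraction is done in
  \<open>int\<close> so that \<open>mod\<close> returns the residue in
  \<open>0, ..., m - 1\<close>.\<close>

definition block_dist :: "nat \<Rightarrow> nat \<Rightarrow> nat" where
  "block_dist a b = nat ((int (b div k) - int (a div k)) mod int m)"

text \<open>Blocks start at multiples of \<open>k\<close>, so modulo \<open>k\<close> the difference
  of the vertices is the difference of their offsets.\<close>

definition offset_dist :: "nat \<Rightarrow> nat \<Rightarrow> nat" where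
  "offset_dist a b = nat ((int b - int a) mod int k)"

text \<open>Every vertex of \<open>A\<close> is smaller than every vertex of \<open>B\<close>, so \<open>Min\<close> and \<open>Max\<close> select the
  endpoints of an edge. The block of \<open>v\<close> is \<open>v div k\<close> modulo \<open>m\<close>.\<close>

definition lam :: "nat set \<Rightarrow> nat" where
  "lam e = block_dist (Min e) (Max e) * k + offset_dist (Min e) (Max e)"

lemma block_dist_less: "block_dist a b < m"
  using m_gt_1 unfolding block_dist_def by (simp add: nat_less_iff)

lemma offset_dist_less: "offset_dist a b < k"
  using k_pos unfolding offset_dist_def by (simp add: nat_less_iff)

lemma A_B_less: "a \<in> A \<Longrightarrow> b \<in> B \<Longrightarrow> a < b"
  unfolding A_def B_def by simp

lemma A_B_disjoint: "A \<inter> B = {}"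
  using A_B_less by fastforce

lemma finite_A: "finite A" and finite_B: "finite B"
  unfolding A_def B_def by simp_all

lemma card_A: "card A = m * k" and card_B: "card B = m * k"
  unfolding A_def B_def by simp_all

lemma A_nonempty: "A \<noteq> {}" and B_nonempty: "B \<noteq> {}"
  using m_gt_1 k_pos unfolding A_def B_def by (auto simp: lessThan_empty_iff)

lemma block_in_A: "a \<in> A \<Longrightarrow> a div k < m"
  unfolding A_def using k_pos by (simp add: less_mult_imp_div_less)

lemma block_in_B:
  assumes "b \<in> B"
  shows "m \<le> b div k" "b div k < 2 * m"
proof -
  show "m \<le> b div k"
    using assms k_pos unfolding B_def by (simp add: less_eq_div_iff_mult_less_eq)
  show "b div k < 2 * m"
    using assms unfolding B_def by (auto intro: less_mult_imp_div_less simp: mult.assoc)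
qed

lemma lam_edge:
  assumes "a \<in> A" "b \<in> B"
  shows "lam {a, b} = block_dist a b * k + offset_dist a b"
    and "lam {b, a} = block_dist a b * k + offset_dist a b"
  using A_B_less[OF assms] unfolding lam_def by (simp_all add: insert_commute min_def max_def)

text \<open>The offset distance is below \<open>k\<close>, hence it is the last digit of the label
  in base \<open>k\<close>. Labels are thus ordered lexicographically, and comparing labels after
  \<open>div k\<close> compares block distances weakly.\<close>

lemma lam_div:
  assumes "a \<in> A" "b \<in> B"
  shows "lam {a, b} div k = block_dist a b" "lam {b, a} div k = block_dist a b"
  using offset_dist_less[of a b] by (simp_all add: lam_edge[OF assms])

lemma lam_mod:
  assumes "a \<in> A" "b \<in> B"
  shows "lam {a, b} mod k = offset_dist a b"
  using offset_dist_less[of a b] by (simp add: lam_edge[OF assms])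

lemma block_dist_cong:
  "[int (b div k) = int (a div k) + int (block_dist a b)] (mod int m)"
  using m_gt_1 unfolding block_dist_def cong_def by (simp add: mod_add_right_eq)

lemma block_dist_eqD:
  "block_dist a b = block_dist a' b' \<Longrightarrow>
    [int (b div k) - int (a div k) = int (b' div k) - int (a' div k)] (mod int m)"
  using m_gt_1 unfolding block_dist_def cong_def by (simp add: eq_nat_nat_iff)

lemma offset_dist_eqD:
  "offset_dist a b = offset_dist a' b' \<Longrightarrow> [int b - int a = int b' - int a'] (mod int k)"
  using k_pos unfolding offset_dist_def cong_def by (simp add: eq_nat_nat_iff)

lemma eq_if_block_offset_eq:
  fixes x y :: nat
  assumes "x div k = y div k" "[int x = int y] (mod int k)"
  shows "x = y"
proof -
  have "x mod k = y mod k"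
    using iffD1[OF cong_int_iff assms(2)] unfolding cong_def .
  with assms(1) show ?thesis
    by (metis div_mult_mod_eq)
qed

lemma block_eq_A:
  assumes "a \<in> A" "a' \<in> A" "[int (a div k) = int (a' div k)] (mod int m)"
  shows "a div k = a' div k"
  using cong_int_close_imp_eq[OF assms(3)] block_in_A[OF assms(1)] block_in_A[OF assms(2)] by linarith

lemma block_eq_B:
  assumes "b \<in> B" "b' \<in> B" "[int (b div k) = int (b' div k)] (mod int m)"
  shows "b div k = b' div k"
  using cong_int_close_imp_eq[OF assms(3)] block_in_B[OF assms(1)] block_in_B[OF assms(2)] by linarith

lemma lam_eqD:
  assumes "a \<in> A" "b \<in> B" "a' \<in> A" "b' \<in> B" "lam {a, b} = lam {a', b'}"
  shows "[int (b div k) - int (a div k) = int (b' div k) - int (a' div k)] (mod int m)"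
    and "[int b - int a = int b' - int a'] (mod int k)"
  using assms by (metis block_dist_eqD lam_div(1), metis offset_dist_eqD lam_mod)

section \<open>Edges and local distinctness\<close>

lemma edgeE:
  assumes "e \<in> biclique_edges A B"
  obtains a b where "a \<in> A" "b \<in> B" "e = {a, b}"
  using assms unfolding biclique_edges_def by blast

lemma edge_iff:
  assumes "a \<in> A"
  shows "{a, b} \<in> biclique_edges A B \<longleftrightarrow> b \<in> B"
  using assms A_B_disjoint unfolding biclique_edges_def by (auto simp: doubleton_eq_iff)

lemma edge_iff':
  assumes "b \<in> B"
  shows "{b, a} \<in> biclique_edges A B \<longleftrightarrow> a \<in> A"
  using assms A_B_disjoint unfolding biclique_edges_def by (auto simp: doubleton_eq_iff)

lemma temporal_biclique: "temporal_biclique A B lam"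
  unfolding temporal_biclique_def
  using finite_A finite_B A_nonempty B_nonempty A_B_disjoint by simp

text \<open>Two edges at \<open>v\<close> share their endpoint in \<open>A\<close> or their endpoint
  in \<open>B\<close>. If the labels agree, so do both distances; the shared endpoint cancels from
  the congruences, which leaves equal blocks and equal offsets for the other endpoints.\<close>

lemma locally_distinct: "locally_distinct A B lam"
  unfolding locally_distinct_def
proof (intro ballI inj_onI)
  fix v e e'
  assume e: "e \<in> {e \<in> biclique_edges A B. v \<in> e}" and e': "e' \<in> {e \<in> biclique_edges A B. v \<in> e}"
    and eq: "lam e = lam e'"
  obtain a b where ab: "a \<in> A" "b \<in> B" "e = {a, b}" using e by (auto elim: edgeE)
  obtain a' b' where ab': "a' \<in> A" "b' \<in> B" "e' = {a', b'}" using e' by (auto elim: edgeE)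
  note congs = lam_eqD[OF ab(1,2) ab'(1,2) eq[unfolded ab(3) ab'(3)]]
  consider "a = a'" | "b = b'"
    using e e' ab ab' A_B_disjoint by auto
  then show "e = e'"
  proof cases
    case 1
    then have "b = b'"
      using congs block_eq_B[OF ab(2) ab'(2)] eq_if_block_offset_eq[of b b']
      by (simp add: cong_diff_right_cancel)
    with 1 ab ab' show ?thesis by simp
  next
    case 2
    then have "a = a'"
      using congs block_eq_A[OF ab(1) ab'(1)] eq_if_block_offset_eq[of a a']
      by (simp add: cong_diff_left_cancel)
    with 2 ab ab' show ?thesis by simp
  qed
qed

section \<open>Blocks visited by temporal paths\<close>

lemma hd_path_edges:
  assumes "path_edges (u # w # p) = es" "set es \<subseteq> biclique_edges A B"
  shows "u \<in> A \<and> w \<in> B \<or> u \<in> B \<and> w \<in> A"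
  using assms A_B_disjoint unfolding biclique_edges_def by (auto simp: doubleton_eq_iff)

text \<open>The slack \<open>s\<close>, a lower bound for the block distances along the path, keeps the start between
  the blocks of \<open>a\<close> and \<open>b\<close> when the path is extended by an earlier edge.\<close>

lemma In_path_block:
  assumes "p \<noteq> []" "set (path_edges p) \<subseteq> biclique_edges A B" "sorted (map lam (path_edges p))"
    and "\<forall>e \<in> set (path_edges p). s \<le> lam e div k \<and> lam e div k \<le> t" "s \<le> t"
    and "last p \<in> {a, b}" "a \<in> A" "b \<in> B" "t = block_dist a b"
  shows "\<exists>d::int. [int (hd p div k) = int (a div k) + d] (mod int m) \<and>
    (hd p \<in> A \<longrightarrow> 0 \<le> d \<and> d \<le> int t - int s) \<and> (hd p \<in> B \<longrightarrow> int s \<le> d \<and> d \<le> int t)"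
  using assms(1-6)
proof (induction p arbitrary: s)
  case Nil
  then show ?case by simp
next
  case (Cons u p)
  show ?case
  proof (cases p)
    case Nil
    with Cons.prems have "u = a \<or> u = b" by simp
    then show ?thesis
    proof
      assume "u = a"
      with assms(7,8) A_B_disjoint Cons.prems Nil show ?thesis
        by (intro exI[of _ 0]) auto
    next
      assume "u = b"
      with assms(7,8) A_B_disjoint Cons.prems Nil block_dist_cong[of b a] assms(9) show ?thesis
        by (intro exI[of _ "int t"]) auto
    qed
  next
    case (Cons w q)
    \<comment> \<open>The block distance of the first edge is the new slack, since sortedness makes
      it a lower bound for the rest. Subtracting \<open>?s\<close> from a value in
      \<open>[?s, t]\<close> gives one in \<open>[0, t - s]\<close>, and adding it to a value in
      \<open>[0, t - ?s]\<close> gives one in \<open>[s, t]\<close>, as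
      \<open>s \<le> ?s\<close>.\<close>
    let ?s = "lam {u, w} div k"
    have step: "s \<le> ?s" "?s \<le> t" using Cons.prems Cons by auto
    have "\<forall>e \<in> set (path_edges p). ?s \<le> lam e div k \<and> lam e div k \<le> t"
      using Cons.prems Cons by (auto intro: div_le_mono)
    then obtain d where d: "[int (w div k) = int (a div k) + d] (mod int m)"
      "w \<in> A \<longrightarrow> 0 \<le> d \<and> d \<le> int t - int ?s" "w \<in> B \<longrightarrow> int ?s \<le> d \<and> d \<le> int t"
      using Cons.IH[of ?s] Cons.prems Cons step by auto
    from hd_path_edges[of u w q] Cons.prems(2) Cons
    consider "u \<in> A" "w \<in> B" | "u \<in> B" "w \<in> A" by auto
    then show ?thesis
    proof cases
      case 1
      then have "[int (w div k) = int (u div k) + int ?s] (mod int m)"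
        using block_dist_cong lam_div by simp
      with d(1) have "[int (u div k) + int ?s = int (a div k) + d] (mod int m)"
        using cong_trans cong_sym by blast
      then have "[int (u div k) = int (a div k) + (d - int ?s)] (mod int m)"
        by (simp add: cong_iff_dvd_diff algebra_simps)
      then show ?thesis
        using d 1 step A_B_disjoint by (intro exI[of _ "d - int ?s"]) auto
    next
      case 2
      then have "[int (u div k) = int (w div k) + int ?s] (mod int m)"
        using block_dist_cong lam_div by simp
      also have "[int (w div k) + int ?s = int (a div k) + d + int ?s] (mod int m)"
        using d(1) by (simp add: cong_iff_dvd_diff)
      finally have "[int (u div k) = int (a div k) + (d + int ?s)] (mod int m)"
        by (simp add: add.assoc)
      then show ?thesis
        using d 2 step A_B_disjoint by (intro exI[of _ "d + int ?s"]) auto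
    qed
  qed
qed

text \<open>The counterpart for outgoing paths. Peeling off the first edge now moves the start along
  the path, so its displacement \<open>d\<close> from the reference block \<open>c\<close> is an
  input. A step into \<open>B\<close> adds an edge's block distance and a step into \<open>A\<close>
  subtracts one; as these distances never decrease, \<open>d\<close> stays at least \<open>t\<close>
  in \<open>B\<close> and at most 0 in \<open>A\<close>. The other two bounds widen with
  \<open>s\<close>, and \<open>s < m\<close> limits them at the end.\<close>

lemma Out_path_block:
  assumes "p \<noteq> []" "set (path_edges p) \<subseteq> biclique_edges A B" "sorted (map lam (path_edges p))"
    and "\<forall>e \<in> set (path_edges p). s \<le> lam e div k" "t \<le> s" "s < m"
    and "[int (hd p div k) = c + d] (mod int m)"
    and "hd p \<in> A \<longrightarrow> int t - int s \<le> d \<and> d \<le> 0" "hd p \<in> B \<longrightarrow> int t \<le> d \<and> d \<le> int s"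
  shows "\<exists>d::int. [int (last p div k) = c + d] (mod int m) \<and>
    (last p \<in> A \<longrightarrow> int t - int m < d \<and> d \<le> 0) \<and> (last p \<in> B \<longrightarrow> int t \<le> d \<and> d < int m)"
  using assms
proof (induction p arbitrary: s d)
  case Nil
  then show ?case by simp
next
  case (Cons u p)
  show ?case
  proof (cases p)
    case Nil
    with Cons.prems show ?thesis by (intro exI[of _ d]) auto
  next
    case (Cons w q)
    let ?s = "lam {u, w} div k"
    have s: "s \<le> ?s" "t \<le> ?s" using Cons.prems Cons by auto
    have rest: "\<forall>e \<in> set (path_edges p). ?s \<le> lam e div k"
      using Cons.prems Cons by (auto intro: div_le_mono)
    have d: "[int (u div k) = c + d] (mod int m)" using Cons.prems by simp
    from hd_path_edges[of u w q] Cons.prems(2) Cons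
    consider "u \<in> A" "w \<in> B" | "u \<in> B" "w \<in> A" by auto
    then have "?s < m \<and> (\<exists>d. [int (w div k) = c + d] (mod int m) \<and>
      (w \<in> A \<longrightarrow> int t - int ?s \<le> d \<and> d \<le> 0) \<and> (w \<in> B \<longrightarrow> int t \<le> d \<and> d \<le> int ?s))"
    proof cases
      case 1
      then have "[int (w div k) = int (u div k) + int ?s] (mod int m)"
        using block_dist_cong lam_div by simp
      also have "[int (u div k) + int ?s = c + d + int ?s] (mod int m)"
        using d by (simp add: cong_iff_dvd_diff)
      finally have "[int (w div k) = c + (d + int ?s)] (mod int m)"
        by (simp add: add.assoc)
      moreover have "?s < m" using 1 lam_div block_dist_less by simp
      ultimately show ?thesis
        using 1 Cons.prems s A_B_disjoint by (intro conjI exI[of _ "d + int ?s"]) auto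
    next
      case 2
      then have "[int (u div k) = int (w div k) + int ?s] (mod int m)"
        using block_dist_cong lam_div by simp
      with d have "[int (w div k) + int ?s = c + d] (mod int m)"
        using cong_trans cong_sym by blast
      then have "[int (w div k) = c + (d - int ?s)] (mod int m)"
        by (simp add: cong_iff_dvd_diff algebra_simps)
      moreover have "?s < m" using 2 lam_div block_dist_less by simp
      ultimately show ?thesis
        using 2 Cons.prems s A_B_disjoint by (intro conjI exI[of _ "d - int ?s"]) auto
    qed
    then obtain d' where "?s < m" "[int (w div k) = c + d'] (mod int m)"
      "w \<in> A \<longrightarrow> int t - int ?s \<le> d' \<and> d' \<le> 0" "w \<in> B \<longrightarrow> int t \<le> d' \<and> d' \<le> int ?s"
      by blast
    then show ?thesis
      using Cons.IH[of ?s d'] rest s Cons.prems Cons by auto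
  qed
qed

text \<open>Let \<open>t\<close> be the block distance of the edge. Relative to the block of
  \<open>a\<close>, the displacements on incoming paths lie in \<open>[0, t]\<close>; those on
  outgoing paths lie in \<open>(t - m, 0]\<close> for \<open>A\<close> and in \<open>[t, m)\<close>
  for \<open>B\<close>. Two such values for the same vertex are congruent modulo \<open>m\<close>
  and differ by less than \<open>m\<close>, so they coincide: at 0, the block of \<open>a\<close>,
  or at \<open>t\<close>, the block of \<open>b\<close>.\<close>

lemma In_Out_block:
  assumes "a \<in> A" "b \<in> B" "v \<in> In_edge A B lam {a, b} \<inter> Out_edge A B lam {a, b}"
  shows "v \<in> A \<and> v div k = a div k \<or> v \<in> B \<and> v div k = b div k"
proof -
  let ?t = "block_dist a b"
  obtain p where p: "temporal_path A B lam p" "hd p = v" "last p \<in> {a, b}"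
    "\<forall>e \<in> set (path_edges p). lam e \<le> lam {a, b}"
    using assms(3) unfolding In_edge_def In_vertex_def by blast
  obtain q where q: "temporal_path A B lam q" "last q = v" "hd q \<in> {a, b}"
    "\<forall>e \<in> set (path_edges q). lam {a, b} \<le> lam e"
    using assms(3) unfolding Out_edge_def Out_vertex_def by blast
  have "\<forall>e \<in> set (path_edges p). 0 \<le> lam e div k \<and> lam e div k \<le> ?t"
    using p(4) lam_div[OF assms(1,2)] by (metis div_le_mono zero_le)
  then obtain d where d: "[int (v div k) = int (a div k) + d] (mod int m)"
    "v \<in> A \<longrightarrow> 0 \<le> d \<and> d \<le> int ?t" "v \<in> B \<longrightarrow> 0 \<le> d \<and> d \<le> int ?t"
    using In_path_block[of p 0 ?t a b] p assms(1,2) unfolding temporal_path_def by auto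
  have q_ge: "\<forall>e \<in> set (path_edges q). ?t \<le> lam e div k"
    using q(4) lam_div[OF assms(1,2)] by (metis div_le_mono)
  \<comment> \<open>With the initial bound \<open>s\<close> equal to \<open>t\<close>, the invariant
    for outgoing paths pins the displacement to 0 at \<open>a\<close> and to \<open>t\<close> at
    \<open>b\<close>.\<close>
  obtain d0 where d0: "[int (hd q div k) = int (a div k) + d0] (mod int m)"
    "hd q \<in> A \<longrightarrow> int ?t - int ?t \<le> d0 \<and> d0 \<le> 0" "hd q \<in> B \<longrightarrow> int ?t \<le> d0 \<and> d0 \<le> int ?t"
  proof -
    have "hd q = a \<or> hd q = b" using q(3) by simp
    then show thesis
    proof
      assume "hd q = a"
      then show thesis using that[of 0] assms(1,2) A_B_disjoint by auto
    next
      assume "hd q = b"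
      then show thesis
        using that[of "int ?t"] assms(1,2) A_B_disjoint block_dist_cong[of b a] by auto
    qed
  qed
  have q': "q \<noteq> []" "set (path_edges q) \<subseteq> biclique_edges A B" "sorted (map lam (path_edges q))"
    using q(1) unfolding temporal_path_def by simp_all
  obtain d' where d': "[int (v div k) = int (a div k) + d'] (mod int m)"
    "v \<in> A \<longrightarrow> int ?t - int m < d' \<and> d' \<le> 0" "v \<in> B \<longrightarrow> int ?t \<le> d' \<and> d' < int m"
    using Out_path_block[OF q' q_ge order.refl block_dist_less d0] q(2) by blast
  have dd': "[d = d'] (mod int m)"
    using d(1) d'(1) cong_trans cong_sym cong_add_lcancel by blast
  have "v \<in> A \<union> B"
    using p(1,2) unfolding temporal_path_def by (metis hd_in_set subsetD)
  then show ?thesis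
  proof
    assume v: "v \<in> A"
    then have "d = d'" using cong_int_close_imp_eq[OF dd'] d(2) d'(2) by linarith
    with v d d' have "d = 0" by auto
    then show ?thesis using v d(1) block_eq_A[OF v assms(1)] by simp
  next
    assume v: "v \<in> B"
    then have "d = d'" using cong_int_close_imp_eq[OF dd'] d(3) d'(3) by linarith
    with v d d' have "d = int ?t" by auto
    then have "[int (v div k) = int (b div k)] (mod int m)"
      using d(1) block_dist_cong[of b a] cong_trans cong_sym by blast
    then show ?thesis using v block_eq_B[OF v assms(2)] by simp
  qed
qed

lemma card_block: "card {v. v div k = i} = k" and finite_block: "finite {v. v div k = i}"
proof -
  have "{v. v div k = i} = {i * k..<i * k + k}"
    using k_pos dividend_less_times_div[OF k_pos]
    by (auto simp: div_nat_eqI mult.commute add.commute)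
  then show "card {v. v div k = i} = k" "finite {v. v div k = i}" by simp_all
qed

lemma card_In_Out_le:
  assumes "e \<in> biclique_edges A B"
  shows "card (In_edge A B lam e \<inter> Out_edge A B lam e) \<le> 2 * k"
proof -
  obtain a b where ab: "a \<in> A" "b \<in> B" "e = {a, b}" using assms by (elim edgeE)
  have "In_edge A B lam e \<inter> Out_edge A B lam e \<subseteq> {v. v div k = a div k} \<union> {v. v div k = b div k}"
    using In_Out_block[OF ab(1,2)] ab(3) by blast
  then have "card (In_edge A B lam e \<inter> Out_edge A B lam e)
      \<le> card ({v. v div k = a div k} \<union> {v. v div k = b div k})"
    using finite_block by (intro card_mono) auto
  also have "\<dots> \<le> 2 * k"
    using card_Un_le[of "{v. v div k = a div k}" "{v. v div k = b div k}"] by (simp add: card_block)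
  finally show ?thesis .
qed

section \<open>Extremal neighbors\<close>

lemma pi_minus_eq:
  assumes "a \<in> A"
  shows "pi_minus A B lam a = a + m * k"
  unfolding pi_minus_def
proof (rule arg_minI)
  have in_B: "a + m * k \<in> B" using assms unfolding A_def B_def by (simp add: mult.commute)
  \<comment> \<open>The copy of \<open>a\<close> in \<open>B\<close> has the same block modulo
    \<open>m\<close> and the same offset, so this edge has the least possible label 0.\<close>
  have "block_dist a (a + m * k) = 0" "offset_dist a (a + m * k) = 0"
    unfolding block_dist_def offset_dist_def using k_pos by simp_all
  then have zero: "lam {a, a + m * k} = 0" using lam_edge(1)[OF assms in_B] by simp
  show "{a, a + m * k} \<in> biclique_edges A B" using in_B edge_iff[OF assms] by simp
  show "\<not> lam {a, u} < lam {a, a + m * k}" for u using zero by simp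
  fix u
  assume u: "{a, u} \<in> biclique_edges A B"
    and min: "\<forall>w. {a, w} \<in> biclique_edges A B \<longrightarrow> \<not> lam {a, w} < lam {a, u}"
  have "u \<in> B" using u edge_iff[OF assms] by simp
  have "lam {a, u} = lam {a, a + m * k}"
    using min zero in_B edge_iff[OF assms] by auto
  then have "{a, u} = {a, a + m * k}"
    using locally_distinct u in_B edge_iff[OF assms] assms
    unfolding locally_distinct_def inj_on_def by auto
  then show "u = a + m * k" by (auto simp: doubleton_eq_iff)
qed

lemma pi_plus_block:
  assumes "b \<in> B"
  shows "pi_plus A B lam b \<in> A" "block_dist (pi_plus A B lam b) b = m - 1"
proof -
  \<comment> \<open>The block of \<open>w\<close> and its offset are the cyclic successors of those
    of \<open>b\<close>. Both distances from \<open>w\<close> to \<open>b\<close> are then -1 modulo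
    \<open>m\<close> and \<open>k\<close>, that is, the maximal values \<open>m - 1\<close> and
    \<open>k - 1\<close>.\<close>
  define w where "w = ((b div k + 1) mod m) * k + (b + 1) mod k"
  have w_div: "w div k = (b div k + 1) mod m" and w_mod: "[int w = int b + 1] (mod int k)"
    using k_pos unfolding w_def cong_def by (simp_all add: of_nat_mod mod_simps add.commute)
  have "(b div k + 1) mod m < m" using m_gt_1 by simp
  then have "((b div k + 1) mod m + 1) * k \<le> m * k" by (intro mult_le_mono1) simp
  moreover have "(b + 1) mod k < k" using k_pos by simp
  ultimately have w: "w \<in> A"
    unfolding A_def w_def by simp
  have "(int (b div k) - int (w div k)) mod int m = (- 1) mod int m"
    unfolding w_div by (simp add: of_nat_mod mod_simps)
  also have "\<dots> = int m - 1" using m_gt_1 by (simp add: zmod_minus1)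
  finally have w_block: "block_dist w b = m - 1"
    unfolding block_dist_def by simp
  have "(int b - int w) mod int k = (- 1) mod int k"
    using cong_diff[OF cong_refl[of "int b"] w_mod] unfolding cong_def by simp
  also have "\<dots> = int k - 1" using k_pos by (simp add: zmod_minus1)
  finally have w_offset: "offset_dist w b = k - 1"
    unfolding offset_dist_def by simp
  have le: "lam {b, u} \<le> lam {b, w}" if "u \<in> A" for u
  proof -
    have "block_dist u b \<le> m - 1" "offset_dist u b \<le> k - 1"
      using block_dist_less[of u b] offset_dist_less[of u b] by simp_all
    then show ?thesis
      using that assms w w_block w_offset by (auto simp: lam_edge intro!: add_mono)
  qed
  have "pi_plus A B lam b \<in> A \<and> block_dist (pi_plus A B lam b) b = m - 1"
    unfolding pi_plus_def
  proof (rule arg_maxI)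
    show "{b, w} \<in> biclique_edges A B" using w edge_iff'[OF assms] by simp
    show "\<not> lam {b, u} > lam {b, w}" if "{b, u} \<in> biclique_edges A B" for u
      using le that edge_iff'[OF assms] by (simp add: not_less)
    fix u
    assume u: "{b, u} \<in> biclique_edges A B"
      and max: "\<forall>x. {b, x} \<in> biclique_edges A B \<longrightarrow> \<not> lam {b, x} > lam {b, u}"
    have "u \<in> A" using u edge_iff'[OF assms] by simp
    moreover have "lam {b, w} \<le> lam {b, u}"
      using max w edge_iff'[OF assms] by (simp add: not_less)
    then have "block_dist w b \<le> block_dist u b"
      using div_le_mono lam_div(2)[OF w assms] lam_div(2)[OF \<open>u \<in> A\<close> assms] by metis
    ultimately show "u \<in> A \<and> block_dist u b = m - 1"
      using w_block block_dist_less[of u b] by simp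
  qed
  then show "pi_plus A B lam b \<in> A" "block_dist (pi_plus A B lam b) b = m - 1" by simp_all
qed

section \<open>Non-reverted edges\<close>

lemma lam_less_if_block_dist_less:
  assumes "a \<in> A" "b \<in> B" "a' \<in> A" "b' \<in> B" "block_dist a b < block_dist a' b'"
  shows "lam {a, b} < lam {a', b'}"
  using assms lam_div(1) by (metis div_le_mono leD not_less)

text \<open>Modulo \<open>m\<close>, the block of \<open>pi_plus A B lam b'\<close> is the one after
  the common block of \<open>a'\<close> and \<open>b'\<close>. Its distance to the block of
  \<open>b\<close> is therefore one less than that of \<open>a'\<close>, without wrapping around
  because \<open>b\<close> lies in another block than \<open>b'\<close>.\<close>

lemma block_dist_pi_plus_less:
  assumes "a' \<in> A" "b \<in> B" "b' \<in> B" "b' div k = a' div k + m" "b div k \<noteq> b' div k"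
  shows "block_dist (pi_plus A B lam b') b < block_dist a' b"
proof -
  let ?q = "pi_plus A B lam b'"
  define r where "r = block_dist a' b"
  have "[int (b div k) = int (a' div k) + int r] (mod int m)"
    unfolding r_def by (rule block_dist_cong)
  moreover have "int (b' div k) + int r = int (a' div k) + int r + int m" using assms(4) by simp
  ultimately have r: "[int (b div k) = int (b' div k) + int r] (mod int m)"
    unfolding cong_def by (simp only: mod_add_self2)
  have "r \<noteq> 0"
    using r block_eq_B[OF assms(2,3)] assms(5) by (intro notI) simp
  have "[int (b' div k) = int (?q div k) + int (m - 1)] (mod int m)"
    using block_dist_cong[of b' ?q] pi_plus_block(2)[OF assms(3)] by simp
  then have q: "int m dvd int (b' div k) - int (?q div k) - int (m - 1)"
    by (simp add: cong_iff_dvd_diff algebra_simps)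
  have b: "int m dvd int (b div k) - int (?q div k) - int (block_dist ?q b)"
    using block_dist_cong[of b ?q] by (simp add: cong_iff_dvd_diff algebra_simps)
  have b': "int m dvd int (b div k) - int (b' div k) - int r"
    using r by (simp add: cong_iff_dvd_diff algebra_simps)
  \<comment> \<open>Combining the three congruences cancels all blocks; subtracting another
    \<open>m\<close> turns the remaining \<open>m - 1\<close> into -1.\<close>
  have "int m dvd (int (b div k) - int (?q div k) - int (block_dist ?q b))
      - (int (b' div k) - int (?q div k) - int (m - 1)) - (int (b div k) - int (b' div k) - int r)
      - int m"
    by (rule dvd_diff[OF dvd_diff[OF dvd_diff[OF b q] b'] dvd_refl])
  also have "\<dots> = (int r - 1) - int (block_dist ?q b)"
    using m_gt_1 by (simp add: of_nat_diff)
  finally have "[int r - 1 = int (block_dist ?q b)] (mod int m)"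
    by (simp add: cong_iff_dvd_diff)
  moreover have "r < m" unfolding r_def by (rule block_dist_less)
  ultimately have "int r - 1 = int (block_dist ?q b)"
    using \<open>r \<noteq> 0\<close> block_dist_less[of ?q b] by (intro cong_int_close_imp_eq) auto
  then show ?thesis unfolding r_def by linarith
qed

text \<open>The first inequality in the definition of \<open>reverted\<close> already fails on block
  distances. In the second, \<open>pi_minus A B lam a'\<close> is the copy of \<open>a'\<close> and
  lies in the block of \<open>b'\<close>, so block distances from \<open>a\<close> tie and the
  offset distances decide.\<close>

lemma non_reverted_edge:
  assumes "a \<in> A" "b \<in> B" "a' \<in> A" "b' \<in> B" "b' div k = a' div k + m" "b div k \<noteq> b' div k"
    and "offset_dist a b' < offset_dist a a'"
  shows "{a', b'} \<in> non_reverted A B lam {a, b}"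
proof -
  have less1: "lam {pi_plus A B lam b', b} < lam {a', b}"
    using assms pi_plus_block(1) block_dist_pi_plus_less lam_less_if_block_dist_less by blast
  have "a' + m * k \<in> B" using assms(3) unfolding A_def B_def by (simp add: mult.commute)
  moreover have "block_dist a (a' + m * k) = block_dist a b'"
    using assms(5) k_pos unfolding block_dist_def by (simp add: add.commute)
  moreover have "offset_dist a (a' + m * k) = offset_dist a a'"
    unfolding offset_dist_def by (simp add: diff_add_eq[symmetric])
  ultimately have less2: "lam {b', a} < lam {pi_minus A B lam a', a}"
    using assms lam_edge(2) pi_minus_eq by simp
  have "\<not> reverted A B lam {a, b} {a', b'}"
    unfolding reverted_def using less1 less2 assms A_B_disjoint
    by (auto simp: doubleton_eq_iff)
  then show ?thesis
    unfolding non_reverted_def biclique_edges_def using assms by blast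
qed

text \<open>This parametrizes the vertices of block \<open>c\<close> by their offset distance
  \<open>u\<close> from \<open>a\<close>.\<close>

lemma offset_dist_add_mod:
  assumes "u < k"
  shows "offset_dist a (c * k + (a + u) mod k) = u"
proof -
  have "[c * k + (a + u) mod k = a + u] (mod k)" unfolding cong_def by simp
  then have "[int (c * k + (a + u) mod k) - int a = int (a + u) - int a] (mod int k)"
    unfolding cong_diff_right_cancel cong_int_iff .
  then show ?thesis unfolding offset_dist_def cong_def using assms by simp
qed

lemma finite_edges: "finite (biclique_edges A B)"
proof -
  have "biclique_edges A B = (\<lambda>(a, b). {a, b}) ` (A \<times> B)"
    unfolding biclique_edges_def by auto
  then show ?thesis using finite_A finite_B by simp
qed

lemma edges_nonempty: "biclique_edges A B \<noteq> {}"
  using A_nonempty B_nonempty unfolding biclique_edges_def by blast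

lemma card_non_reverted_ge:
  assumes "e \<in> biclique_edges A B"
  shows "(m - 1) * (k * (k - 1)) \<le> 2 * card (non_reverted A B lam e)"
proof -
  obtain a b where ab: "a \<in> A" "b \<in> B" "e = {a, b}" using assms by (elim edgeE)
  \<comment> \<open>A triple \<open>(i, u, v)\<close> with \<open>v < u < k\<close> stands for the
    edge inside block \<open>i\<close> whose endpoints \<open>x\<close> in \<open>A\<close> and
    \<open>y\<close> in \<open>B\<close> have offset distances \<open>u\<close> and \<open>v\<close>
    from \<open>a\<close>. The removed index is that of the block of \<open>b\<close>. Block and
    offset distances recover the triple, so distinct triples give distinct edges.\<close>
  define I where "I = ({..<m} - {b div k - m}) \<times> (SIGMA u:{..<k}. {..<u})"
  define x where "x = (\<lambda>(i, u, v::nat). i * k + (a + u) mod k)"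
  define y where "y = (\<lambda>(i, u::nat, v). (m + i) * k + (a + v) mod k)"
  have x_A: "x z \<in> A" and y_B: "y z \<in> B" if z_I: "z \<in> I" for z
  proof -
    obtain i u v where z: "z = (i, u, v)" by (cases z)
    have "i < m" using z_I unfolding z I_def by simp
    then have "(i + 1) * k \<le> m * k" by (intro mult_le_mono1) simp
    then have "i * k + w mod k < m * k" for w
      using mod_less_divisor[OF k_pos, of w] unfolding add_mult_distrib by linarith
    from this[of "a + u"] this[of "a + v"] show "x z \<in> A" "y z \<in> B"
      unfolding z x_def y_def A_def B_def by (simp_all add: add_mult_distrib mult.commute[of m])
  qed
  have x_div: "x (i, u, v) div k = i" and y_div: "y (i, u, v) div k = m + i" for i u v
    using k_pos unfolding x_def y_def by simp_all
  have x_off: "offset_dist a (x (i, u, v)) = u" and y_off: "offset_dist a (y (i, u, v)) = v"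
    if "(i, u, v) \<in> I" for i u v
    using that offset_dist_add_mod unfolding x_def y_def I_def by auto
  have "inj_on (\<lambda>z. {x z, y z}) I"
  proof (rule inj_onI)
    fix z z'
    assume zz': "z \<in> I" "z' \<in> I" "{x z, y z} = {x z', y z'}"
    then have eq: "x z = x z'" "y z = y z'"
      using x_A[OF zz'(1)] y_B[OF zz'(2)] A_B_disjoint by (auto simp: doubleton_eq_iff)
    obtain i u v i' u' v' where z: "z = (i, u, v)" "z' = (i', u', v')"
      by (cases z; cases z')
    show "z = z'"
      using eq zz'(1,2) x_div x_off y_off unfolding z by metis
  qed
  moreover have "(\<lambda>z. {x z, y z}) ` I \<subseteq> non_reverted A B lam e"
  proof clarify
    fix i u v
    assume z: "(i, u, v) \<in> I"
    have "offset_dist a (y (i, u, v)) < offset_dist a (x (i, u, v))"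
      unfolding x_off[OF z] y_off[OF z] using z unfolding I_def by simp
    moreover have "b div k \<noteq> y (i, u, v) div k"
      unfolding y_div using z unfolding I_def by auto
    ultimately show "{x (i, u, v), y (i, u, v)} \<in> non_reverted A B lam e"
      unfolding ab(3) using ab z x_A y_B x_div y_div by (intro non_reverted_edge) auto
  qed
  moreover have "finite (non_reverted A B lam e)"
    unfolding non_reverted_def using finite_edges by simp
  ultimately have le: "card I \<le> card (non_reverted A B lam e)"
    by (metis card_image card_mono)
  \<comment> \<open>The removed index is indeed below \<open>m\<close>, so exactly
    \<open>m - 1\<close> blocks remain.\<close>
  have "b div k - m < m" using block_in_B[OF ab(2)] by simp
  then have "2 * card I = (m - 1) * (2 * (\<Sum>u<k. u))"
    unfolding I_def by (simp add: card_cartesian_product)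
  also have "\<dots> = (m - 1) * (k * (k - 1))" by (simp only: two_sum_lessThan)
  finally show ?thesis using le by simp
qed

lemma Max_In_Out_le:
  "(MAX e \<in> biclique_edges A B. card (In_edge A B lam e \<inter> Out_edge A B lam e)) \<le> 2 * k"
  using finite_edges edges_nonempty card_In_Out_le by (intro Max.boundedI) auto

lemma Min_non_reverted_ge:
  "(m - 1) * (k * (k - 1)) \<le> 2 * (MIN e \<in> biclique_edges A B. card (non_reverted A B lam e))"
proof -
  have "(MIN e \<in> biclique_edges A B. card (non_reverted A B lam e))
      \<in> (\<lambda>e. card (non_reverted A B lam e)) ` biclique_edges A B"
    using finite_edges edges_nonempty by (intro Min_in) auto
  then show ?thesis using card_non_reverted_ge by auto
qed

end

section \<open>Choice of the parameters and asymptotics\<close>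

theorem theorem39:
  fixes f :: "nat \<Rightarrow> nat"
  assumes "\<And>n. f n > 0"
    and "(\<lambda>n. real (f n)) \<in> O(\<lambda>n. real n)"
  shows "\<exists>(A :: nat \<Rightarrow> nat set) (B :: nat \<Rightarrow> nat set) (lam :: nat \<Rightarrow> nat set \<Rightarrow> nat).
    (\<forall>n. temporal_biclique (A n) (B n) (lam n) \<and> locally_distinct (A n) (B n) (lam n)) \<and>
    (\<forall>n. card (A n) = card (B n)) \<and>
    (\<lambda>n. real (card (A n))) \<in> \<Theta>(\<lambda>n. real n) \<and>
    (\<lambda>n. real (MAX e \<in> biclique_edges (A n) (B n).
        card (In_edge (A n) (B n) (lam n) e \<inter> Out_edge (A n) (B n) (lam n) e)))
      \<in> O(\<lambda>n. real (f n)) \<and>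
    (\<lambda>n. real (MIN e \<in> biclique_edges (A n) (B n).
        card (non_reverted (A n) (B n) (lam n) e)))
      \<in> \<Omega>(\<lambda>n. real n * real (f n))"
proof -
  \<comment> \<open>The added 1 makes \<open>k n - 1\<close> equal to \<open>min (f n) n\<close>,
    the factor in the lower bound. Capping by \<open>n\<close> keeps the parts of linear size at
    every \<open>n\<close>, even where \<open>f n\<close> exceeds \<open>n\<close>.\<close>
  define k where "k n = min (f n) n + 1" for n
  \<comment> \<open>The added 2 gives \<open>m n > 1\<close> and leaves \<open>m n - 1\<close>
    blocks after one is discarded; these still cover \<open>n\<close>, because
    \<open>n mod k n < k n\<close>.\<close>
  define m where "m n = n div k n + 2" for n
  have bs: "block_shift (m n) (k n)" for n
    by unfold_locales (simp_all add: k_def m_def)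
  let ?A = "\<lambda>n. block_shift.A (m n) (k n)"
  let ?B = "\<lambda>n. block_shift.B (m n) (k n)"
  let ?lam = "\<lambda>n. block_shift.lam (m n) (k n)"
  have size: "n \<le> m n * k n" "n \<le> (m n - 1) * k n" "m n * k n \<le> 3 * n + 2" for n
  proof -
    have "k n * (n div k n) + n mod k n = n" by (rule mult_div_mod_eq)
    moreover have "n mod k n < k n" by (simp add: k_def)
    moreover have "k n \<le> n + 1" by (simp add: k_def)
    moreover have "m n * k n = k n * (n div k n) + 2 * k n"
      "(m n - 1) * k n = k n * (n div k n) + k n"
      unfolding m_def by (simp_all add: algebra_simps)
    ultimately show "n \<le> m n * k n" "n \<le> (m n - 1) * k n" "m n * k n \<le> 3 * n + 2"
      by linarith+
  qed
  have "(\<lambda>n. real (card (?A n))) \<in> \<Theta>(\<lambda>n. real n)"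
  proof (rule bigthetaI)
    show "(\<lambda>n. real (card (?A n))) \<in> O(\<lambda>n. real n)"
    \<comment> \<open>For \<open>n \<ge> 1\<close> the size bound \<open>3 * n + 2\<close> is at
      most \<open>5 * n\<close>.\<close>
    proof (rule bigoI[of _ 5], rule eventually_mono[OF eventually_ge_at_top[of 1]])
      fix n :: nat
      assume "1 \<le> n"
      with size(3)[of n] have "m n * k n \<le> 5 * n" by simp
      then show "norm (real (card (?A n))) \<le> 5 * norm (real n)"
        unfolding block_shift.card_A[OF bs] by (simp flip: of_nat_mult)
    qed
    show "(\<lambda>n. real (card (?A n))) \<in> \<Omega>(\<lambda>n. real n)"
    proof (rule landau_omega.bigI[of 1])
      show "\<forall>\<^sub>F n in sequentially. 1 * norm (real n) \<le> norm (real (card (?A n)))"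
        using size(1) unfolding block_shift.card_A[OF bs] by (simp flip: of_nat_mult)
    qed simp
  qed
  moreover have "(\<lambda>n. real (MAX e \<in> biclique_edges (?A n) (?B n).
        card (In_edge (?A n) (?B n) (?lam n) e \<inter> Out_edge (?A n) (?B n) (?lam n) e)))
      \<in> O(\<lambda>n. real (f n))"
  proof (rule bigoI[of _ 4], rule always_eventually, rule allI)
    fix n
    \<comment> \<open>Positivity of \<open>f\<close> absorbs the added 1:
      \<open>k n \<le> f n + 1 \<le> 2 * f n\<close>.\<close>
    have "2 * k n \<le> 4 * f n" using assms(1)[of n] unfolding k_def by simp
    then show "norm (real (MAX e \<in> biclique_edges (?A n) (?B n).
        card (In_edge (?A n) (?B n) (?lam n) e \<inter> Out_edge (?A n) (?B n) (?lam n) e)))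
      \<le> 4 * norm (real (f n))"
      using block_shift.Max_In_Out_le[OF bs, of n] by simp
  qed
  moreover have "(\<lambda>n. real (MIN e \<in> biclique_edges (?A n) (?B n).
        card (non_reverted (?A n) (?B n) (?lam n) e)))
      \<in> \<Omega>(\<lambda>n. real n * real (f n))"
  proof -
    obtain C where C: "C > 0" "\<forall>\<^sub>F n in sequentially. norm (real (f n)) \<le> C * norm (real n)"
      using assms(2) by (elim landau_o.bigE)
    \<comment> \<open>The factor \<open>max C 1\<close> bounds \<open>f n\<close> by a multiple of
      \<open>min (f n) n\<close>, whichever of the two is smaller; the 2 comes from the doubled
      count of non-reverted edges.\<close>
    define c where "c = 1 / (2 * max C 1)"
    have "\<forall>\<^sub>F n in sequentially. c * norm (real n * real (f n)) \<le>
      norm (real (MIN e \<in> biclique_edges (?A n) (?B n).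
        card (non_reverted (?A n) (?B n) (?lam n) e)))"
      using C(2)
    proof eventually_elim
      case (elim n)
      let ?M = "MIN e \<in> biclique_edges (?A n) (?B n). card (non_reverted (?A n) (?B n) (?lam n) e)"
      have "real (f n) \<le> max C 1 * real (f n)" "C * real n \<le> max C 1 * real n"
        by (simp_all add: mult_right_mono mult_le_cancel_right1)
      with elim have "real (f n) \<le> max C 1 * real (min (f n) n)"
        by (auto simp: min_def)
      then have "real n * real (f n) \<le> real n * (max C 1 * real (min (f n) n))"
        by (intro mult_left_mono) auto
      also have "\<dots> = max C 1 * real (n * min (f n) n)" by simp
      also have "n * min (f n) n \<le> 2 * ?M"
      proof -
        have "n * (k n - 1) \<le> (m n - 1) * k n * (k n - 1)"
          using size(2) by (intro mult_le_mono1)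
        also have "\<dots> \<le> 2 * ?M"
          using block_shift.Min_non_reverted_ge[OF bs, of n] by (simp add: mult.assoc)
        finally show ?thesis by (simp add: k_def)
      qed
      finally have "real n * real (f n) \<le> max C 1 * real (2 * ?M)"
        by (simp add: mult_left_mono)
      then show ?case
        unfolding c_def by (simp add: field_simps)
    qed
    moreover have "c > 0" unfolding c_def by simp
    ultimately show ?thesis by (intro landau_omega.bigI)
  qed
  ultimately show ?thesis
    using block_shift.temporal_biclique[OF bs] block_shift.locally_distinct[OF bs]
      block_shift.card_A[OF bs] block_shift.card_B[OF bs]
    by (intro exI[of _ ?A] exI[of _ ?B] exI[of _ ?lam]) simp
qed

end
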